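(* Let $\alpha,\beta,x,y,p\in\mathbb{C}$ with $\mathrm{Re}(x)>0$, $\mathrm{Re}(y)>0$, $\mathrm{Re}(\alpha)>-1$, $\mathrm{Re}(p)>0$. Then the product of two $\Psi$-gamma functions has the integral representation $${}^{\Psi}\Gamma_{p}^{(\alpha,\beta)}(x)\;{}^{\Psi}\Gamma_{p}^{(\alpha,\beta)}(y)=4\int_{0}^{\frac{\pi}{2}}\int_{0}^{\infty}r^{2(x+y)-1} \cos^{2x-1}(\theta) \sin^{2y-1}(\theta)\;{}_{0}\Psi_{1}\left( \alpha,\beta;-r^{2} \cos^{2}(\theta)-\frac{p}{r^{2} \cos^{2}(\theta)}\right)\;{}_{0}\Psi_{1}\left( \alpha,\beta;-r^{2} \sin^{2}(\theta)-\frac{p}{r^{2} \sin^{2}(\theta)}\right)dr\,d\theta.$$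
   Context: For $\alpha,\beta\in\mathbb{C}$ with $\mathrm{Re}(\alpha)>-1$, the Wright function is ${}_{0}\Psi_{1}(\alpha,\beta;z)=\sum_{n=0}^{\infty}\frac{1}{\Gamma(\alpha n+\beta)}\frac{z^n}{n!}$ (with $1/\Gamma$ equal to $0$ at the poles of $\Gamma$). For $\mathrm{Re}(x)>0$, $\mathrm{Re}(\alpha)>-1$, $\mathrm{Re}(p)>0$ the $\Psi$-gamma function is $${}^{\Psi}\Gamma_{p}^{(\alpha,\beta)}(x)=\int_{0}^{\infty}t^{x-1}\,{}_{0}\Psi_{1}\left(\alpha,\beta;-t-\frac{p}{t}\right)dt.$$
   Formalization: The integrals defining the two Ψ-gamma functions at x and y are assumed to converge absolutely; the stated conditions do not ensure convergence (for α=β=p=x=1 the integral diverges), so the left side can be undefined. *)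

theory Defs
  imports "HOL-Analysis.Analysis"
begin

text \<open>The constant \<^const>\<open>rGamma\<close> is the entire function 1/Gamma, which vanishes at the poles of Gamma.\<close>

definition wright :: "complex \<Rightarrow> complex \<Rightarrow> complex \<Rightarrow> complex" where
  "wright \<alpha> \<beta> z = (\<Sum>n. rGamma (\<alpha> * of_nat n + \<beta>) * (z ^ n / fact n))"

definition Psi_gamma_integrand ::
    "complex \<Rightarrow> complex \<Rightarrow> complex \<Rightarrow> complex \<Rightarrow> real \<Rightarrow> complex" where
  "Psi_gamma_integrand \<alpha> \<beta> p x t =
     of_real t powr (x - 1) * wright \<alpha> \<beta> (- of_real t - p / of_real t)"

text \<open>The integral is a Lebesgue integral. The conditions Re x > 0, Re \<alpha> > -1, Re p > 0 do not
  imply that it converges: for \<alpha> = \<beta> = 1 the Wright function at -t is the Bessel function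
  J_0(2 sqrt t), and convergence at infinity is absolute only for Re x < 1/4. The value is
  therefore meaningful only together with the predicate Psi_gamma_converges.\<close>

definition Psi_gamma_converges :: "complex \<Rightarrow> complex \<Rightarrow> complex \<Rightarrow> complex \<Rightarrow> bool" where
  "Psi_gamma_converges \<alpha> \<beta> p x \<longleftrightarrow>
     set_integrable lborel {0<..} (Psi_gamma_integrand \<alpha> \<beta> p x)"

definition Psi_gamma :: "complex \<Rightarrow> complex \<Rightarrow> complex \<Rightarrow> complex \<Rightarrow> complex" where
  "Psi_gamma \<alpha> \<beta> p x = (LBINT t:{0<..}. Psi_gamma_integrand \<alpha> \<beta> p x t)"

end

theory Submission
  imports Defs
begin

text \<open>
  The product of the two integrals is the double integral of \<open>f s * g t\<close> over the quadrant
  \<open>s, t > 0\<close>, and the asserted formula is its expression in the coordinates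
  \<open>s = r\<^sup>2 cos\<^sup>2 \<theta>\<close>, \<open>t = r\<^sup>2 sin\<^sup>2 \<theta>\<close>, whose Jacobian is \<open>4 r\<^sup>3 cos \<theta> sin \<theta>\<close>. Both
  integrals converge absolutely by hypothesis, hence so does the double integral, and Fubini's
  theorem applies to it.

  The planar change of variables is factored into one-dimensional ones. Put \<open>v = t / s\<close>, which is
  \<open>tan\<^sup>2 \<theta>\<close>. For fixed \<open>s\<close> the substitution \<open>t = s v\<close> is a linear scaling
  (\<open>product_of_integrals_ratio\<close>); Fubini's theorem then moves the integral over \<open>v\<close> to the
  outside. There \<open>v = tan\<^sup>2 \<theta>\<close> is substituted, and in the inner integral, for fixed \<open>\<theta>\<close>,
  \<open>s = r\<^sup>2 cos\<^sup>2 \<theta>\<close> (\<open>product_of_integrals_polar\<close>). The theorem follows by collecting the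
  complex powers.
\<close>

text \<open>
  If one side diverges then so does the other, and both have the default value 0. In the polar
  formula this covers the null set of angles at which the inner integral may diverge. Borel
  measurability of \<open>f\<close> is what allows the passage from the Lebesgue measure, for which the change
  of variables is known, to its restriction to Borel sets.
\<close>

lemma set_integral_substitution_lborel:
  fixes f :: "real \<Rightarrow> 'a :: euclidean_space" and g g' :: "real \<Rightarrow> real"
  assumes f [measurable]: "f \<in> borel_measurable borel"
    and S [measurable]: "S \<in> sets borel" and T [measurable]: "g ` S \<in> sets borel"
    and der: "\<And>x. x \<in> S \<Longrightarrow> (g has_field_derivative g' x) (at x)"
    and cont: "continuous_on S g'"
    and nonneg: "\<And>x. x \<in> S \<Longrightarrow> 0 \<le> g' x"
    and inj: "inj_on g S"
  shows "(LBINT x:S. g' x *\<^sub>R f (g x)) = (LBINT y:g ` S. f y)"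
proof -
  let ?h = "\<lambda>x. g' x *\<^sub>R f (g x)"
  have "continuous_on S g"
    using der by (intro continuous_at_imp_continuous_on ballI) (rule DERIV_isCont)
  then have g [measurable]: "(\<lambda>x. indicator S x *\<^sub>R g x) \<in> borel_measurable borel"
    by (intro borel_measurable_continuous_on_indicator) auto
  have g' [measurable]: "(\<lambda>x. indicator S x *\<^sub>R g' x) \<in> borel_measurable borel"
    using cont by (intro borel_measurable_continuous_on_indicator) auto
  have "(\<lambda>x. indicator S x *\<^sub>R (indicator S x *\<^sub>R g' x) *\<^sub>R f (indicator S x *\<^sub>R g x))
          \<in> borel_measurable borel"
    by measurable
  also have "(\<lambda>x. indicator S x *\<^sub>R (indicator S x *\<^sub>R g' x) *\<^sub>R f (indicator S x *\<^sub>R g x))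
               = (\<lambda>x. indicator S x *\<^sub>R ?h x)"
    by (auto simp: indicator_def)
  finally have hm: "(\<lambda>x. indicator S x *\<^sub>R ?h x) \<in> lborel \<rightarrow>\<^sub>M borel"
    by simp
  have fm: "(\<lambda>y. indicator (g ` S) y *\<^sub>R f y) \<in> lborel \<rightarrow>\<^sub>M borel"
    by simp
  have abs: "indicator S x *\<^sub>R (\<bar>g' x\<bar> *\<^sub>R f (g x)) = indicator S x *\<^sub>R ?h x" for x
    using nonneg by (simp add: indicator_def)
  have h_int: "(\<lambda>x. \<bar>g' x\<bar> *\<^sub>R f (g x)) absolutely_integrable_on S \<longleftrightarrow> set_integrable lborel S ?h"
    unfolding set_integrable_def abs using integrable_completion[OF hm] .
  have f_int: "f absolutely_integrable_on g ` S \<longleftrightarrow> set_integrable lborel (g ` S) f"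
    unfolding set_integrable_def using integrable_completion[OF fm] .
  have subst: "((\<lambda>x. \<bar>g' x\<bar> *\<^sub>R f (g x)) absolutely_integrable_on S \<and>
         integral S (\<lambda>x. \<bar>g' x\<bar> *\<^sub>R f (g x)) = b) \<longleftrightarrow>
      (f absolutely_integrable_on g ` S \<and> integral (g ` S) f = b)" for b
    using inj by (intro has_absolute_integral_change_of_variables_real)
      (auto intro: has_field_derivative_at_within der)
  show ?thesis
  proof (cases "set_integrable lborel (g ` S) f")
    case True
    with subst h_int f_int have h: "set_integrable lborel S ?h"
      and eq: "integral S (\<lambda>x. \<bar>g' x\<bar> *\<^sub>R f (g x)) = integral (g ` S) f"
      by blast+
    have "(LBINT x:S. ?h x) = integral S ?h"
      by (rule set_borel_integral_eq_integral(2)[OF h])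
    also have "\<dots> = integral S (\<lambda>x. \<bar>g' x\<bar> *\<^sub>R f (g x))"
      using nonneg by (intro Henstock_Kurzweil_Integration.integral_cong) simp
    finally show ?thesis
      using eq set_borel_integral_eq_integral(2)[OF True] by simp
  next
    case False
    with subst h_int f_int have "\<not> set_integrable lborel S ?h"
      by blast
    with False show ?thesis
      unfolding set_lebesgue_integral_def set_integrable_def
      by (simp add: not_integrable_integral_eq)
  qed
qed

text \<open>
  Absolute convergence of the new double integral is checked by integrating over \<open>v\<close> first: the
  factor \<open>s\<close> is the Jacobian of \<open>v \<mapsto> s v\<close>, so the inner integral of the norm is the constant
  \<open>\<integral>|G|\<close> times \<open>|F s|\<close>.
\<close>

lemma product_of_integrals_ratio:
  fixes F G :: "real \<Rightarrow> complex"
  assumes F: "integrable lborel F" and G: "integrable lborel G"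
    and F0: "\<And>s. s \<le> 0 \<Longrightarrow> F s = 0"
  shows "(LBINT s. F s) * (LBINT t. G t) = (LBINT v. LBINT s. s *\<^sub>R (F s * G (s * v)))"
proof -
  have [measurable]: "F \<in> borel_measurable borel" "G \<in> borel_measurable borel"
    using F G by (simp_all add: borel_measurable_integrable flip: measurable_lborel1)
  let ?H = "\<lambda>s v. s *\<^sub>R (F s * G (s * v))"
  have scale: "(LBINT v. ?H s v) = F s * (LBINT t. G t)" for s
  proof (cases "s > 0")
    case True
    then show ?thesis
      using lborel_integral_real_affine[of s G 0] by (simp add: scaleR_conv_of_real)
  qed (use F0 in simp)
  have scale_norm: "(LBINT v. norm (?H s v)) = norm (F s) * (LBINT t. norm (G t))" for s
  proof (cases "s > 0")
    case True
    then show ?thesis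
      using lborel_integral_real_affine[of s "\<lambda>t. norm (G t)" 0]
      by (simp add: norm_mult)
  qed (use F0 in simp)
  have "integrable lborel (\<lambda>v. ?H s v)" for s
  proof (cases "s > 0")
    case True
    then show ?thesis
      using lborel_integrable_real_affine[OF G, of s 0] by simp
  qed (use F0 in simp)
  then have int: "integrable (lborel \<Otimes>\<^sub>M lborel) (\<lambda>(s, v). ?H s v)"
  proof (intro lborel_pair.Fubini_integrable)
    show "integrable lborel (\<lambda>s. LBINT v. norm (case (s, v) of (s, v) \<Rightarrow> ?H s v))"
      unfolding prod.case scale_norm using F by simp
  qed simp_all
  have "(LBINT s. F s) * (LBINT t. G t) = (LBINT s. LBINT v. ?H s v)"
    by (simp only: scale) simp
  also have "\<dots> = (LBINT v. LBINT s. ?H s v)"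
    by (rule lborel_pair.Fubini_integral[OF int, symmetric])
  finally show ?thesis .
qed

lemma image_tan_squared: "(\<lambda>\<theta>. (tan \<theta>)\<^sup>2) ` {0<..<pi/2} = {0<..}"
proof (intro equalityI subsetI)
  fix v :: real assume "v \<in> {0<..}"
  then have "arctan (sqrt v) \<in> {0<..<pi/2}" "v = (tan (arctan (sqrt v)))\<^sup>2"
    using arctan_ubound by (auto simp: tan_arctan)
  then show "v \<in> (\<lambda>\<theta>. (tan \<theta>)\<^sup>2) ` {0<..<pi/2}" by blast
qed (use tan_gt_zero in force)

lemma image_scaled_square:
  fixes a :: real
  assumes "a > 0"
  shows "(\<lambda>r. r\<^sup>2 * a) ` {0<..} = {0<..}"
proof (intro equalityI subsetI)
  fix v :: real assume "v \<in> {0<..}"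
  then have "sqrt (v / a) \<in> {0<..}" "v = (sqrt (v / a))\<^sup>2 * a"
    using assms by auto
  then show "v \<in> (\<lambda>r. r\<^sup>2 * a) ` {0<..}" by blast
qed (use assms in auto)

lemma inj_on_tan_squared: "inj_on (\<lambda>\<theta>. (tan \<theta>)\<^sup>2) {0<..<pi/2}"
proof (rule inj_onI)
  fix \<theta> \<phi> assume *: "\<theta> \<in> {0<..<pi/2}" "\<phi> \<in> {0<..<pi/2}" "(tan \<theta>)\<^sup>2 = (tan \<phi>)\<^sup>2"
  then have "tan \<theta> = tan \<phi>"
    using tan_gt_zero[of \<theta>] tan_gt_zero[of \<phi>] by (simp add: power2_eq_iff)
  then have "arctan (tan \<theta>) = arctan (tan \<phi>)" by simp
  then show "\<theta> = \<phi>"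
    using * by (simp add: arctan_tan)
qed

lemma product_of_integrals_polar:
  fixes f g :: "real \<Rightarrow> complex"
  assumes f: "set_integrable lborel {0<..} f" and g: "set_integrable lborel {0<..} g"
  shows "(LBINT s:{0<..}. f s) * (LBINT t:{0<..}. g t) =
    (LBINT \<theta>:{0<..<pi/2}. LBINT r:{0<..}.
       (4 * r ^ 3 * cos \<theta> * sin \<theta>) *\<^sub>R (f (r\<^sup>2 * (cos \<theta>)\<^sup>2) * g (r\<^sup>2 * (sin \<theta>)\<^sup>2)))"
proof -
  \<comment> \<open>Extending by zero makes both functions Borel measurable on the whole line.\<close>
  define F where "F s = indicator {0<..} s *\<^sub>R f s" for s :: real
  define G where "G s = indicator {0<..} s *\<^sub>R g s" for s :: real
  have F: "integrable lborel F" and G: "integrable lborel G"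
    using f g unfolding F_def G_def set_integrable_def by auto
  have [measurable]: "F \<in> borel_measurable borel" "G \<in> borel_measurable borel"
    using F G by (simp_all add: borel_measurable_integrable flip: measurable_lborel1)
  define H where "H v s = s *\<^sub>R (F s * G (s * v))" for v s :: real
  define K where "K v = (LBINT s. H v s)" for v
  have Hm: "H v \<in> borel_measurable borel" for v
    unfolding H_def by measurable
  have Km: "K \<in> borel_measurable borel"
    unfolding K_def H_def by measurable
  have K0: "indicator {0<..} v *\<^sub>R K v = K v" for v
  proof (cases "v > 0")
    case False
    then have "H v s = 0" for s
      unfolding H_def F_def G_def by (auto simp: indicator_def zero_less_mult_iff)
    with False show ?thesis by (simp add: K_def)
  qed simp
  have H0: "indicator {0<..} s *\<^sub>R H v s = H v s" for v s
    unfolding H_def F_def by (simp add: indicator_def)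
  have "(LBINT s:{0<..}. f s) * (LBINT t:{0<..}. g t) = (LBINT s. F s) * (LBINT t. G t)"
    unfolding F_def G_def set_lebesgue_integral_def ..
  also have "\<dots> = (LBINT v. K v)"
    unfolding K_def H_def using F G
    by (rule product_of_integrals_ratio) (simp add: F_def)
  also have "\<dots> = (LBINT v:{0<..}. K v)"
    unfolding set_lebesgue_integral_def K0 ..
  also have "\<dots> = (LBINT \<theta>:{0<..<pi/2}. (2 * tan \<theta> * inverse ((cos \<theta>)\<^sup>2)) *\<^sub>R K ((tan \<theta>)\<^sup>2))"
  proof -
    have cos: "cos \<theta> \<noteq> 0" if "\<theta> \<in> {0<..<pi/2}" for \<theta>
      using that cos_gt_zero_pi[of \<theta>] by auto
    have "(LBINT \<theta>:{0<..<pi/2}. (2 * tan \<theta> * inverse ((cos \<theta>)\<^sup>2)) *\<^sub>R K ((tan \<theta>)\<^sup>2))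
        = (LBINT v:(\<lambda>\<theta>. (tan \<theta>)\<^sup>2) ` {0<..<pi/2}. K v)"
    proof (rule set_integral_substitution_lborel[OF Km _ _ _ _ _ inj_on_tan_squared])
      show "((\<lambda>\<theta>. (tan \<theta>)\<^sup>2) has_field_derivative 2 * tan \<theta> * inverse ((cos \<theta>)\<^sup>2)) (at \<theta>)"
        if "\<theta> \<in> {0<..<pi/2}" for \<theta>
        using cos[OF that] by (auto intro!: derivative_eq_intros)
      show "continuous_on {0<..<pi/2} (\<lambda>\<theta>. 2 * tan \<theta> * inverse ((cos \<theta>)\<^sup>2))"
        using cos by (intro continuous_intros) auto
      show "0 \<le> 2 * tan \<theta> * inverse ((cos \<theta>)\<^sup>2)" if "\<theta> \<in> {0<..<pi/2}" for \<theta>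
        using that tan_gt_zero[of \<theta>] by simp
    qed (simp_all add: image_tan_squared)
    then show ?thesis by (simp add: image_tan_squared)
  qed
  also have "\<dots> = (LBINT \<theta>:{0<..<pi/2}. LBINT r:{0<..}.
       (4 * r ^ 3 * cos \<theta> * sin \<theta>) *\<^sub>R (f (r\<^sup>2 * (cos \<theta>)\<^sup>2) * g (r\<^sup>2 * (sin \<theta>)\<^sup>2)))"
  proof (intro set_lebesgue_integral_cong allI impI)
    fix \<theta> :: real assume \<theta>: "\<theta> \<in> {0<..<pi/2}"
    then have c: "cos \<theta> > 0" and s: "sin \<theta> > 0"
      using cos_gt_zero_pi[of \<theta>] sin_gt_zero[of \<theta>] by auto
    let ?a = "(cos \<theta>)\<^sup>2" and ?v = "(tan \<theta>)\<^sup>2"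
    have img: "(\<lambda>r. r\<^sup>2 * ?a) ` {0<..} = {0<..}"
      using c by (intro image_scaled_square) simp
    have "K ?v = (LBINT s:{0<..}. H ?v s)"
      unfolding K_def set_lebesgue_integral_def H0 ..
    also have "\<dots> = (LBINT r:{0<..}. (2 * r * ?a) *\<^sub>R H ?v (r\<^sup>2 * ?a))"
    proof -
      have "(LBINT r:{0<..}. (2 * r * ?a) *\<^sub>R H ?v (r\<^sup>2 * ?a))
          = (LBINT s:(\<lambda>r. r\<^sup>2 * ?a) ` {0<..}. H ?v s)"
      proof (rule set_integral_substitution_lborel[OF Hm])
        show "((\<lambda>r. r\<^sup>2 * ?a) has_field_derivative 2 * r * ?a) (at r)" for r
          by (auto intro!: derivative_eq_intros)
        show "continuous_on {0<..} (\<lambda>r. 2 * r * ?a)"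
          by (intro continuous_intros)
        show "inj_on (\<lambda>r. r\<^sup>2 * ?a) {0<..}"
          using c by (auto intro!: inj_onI)
      qed (auto simp: img)
      then show ?thesis by (simp add: img)
    qed
    finally have "(2 * tan \<theta> * inverse ?a) *\<^sub>R K ?v =
        (LBINT r:{0<..}. (2 * tan \<theta> * inverse ?a) *\<^sub>R (2 * r * ?a) *\<^sub>R H ?v (r\<^sup>2 * ?a))"
      by (simp only: set_integral_scaleR_right)
    also have "\<dots> = (LBINT r:{0<..}.
       (4 * r ^ 3 * cos \<theta> * sin \<theta>) *\<^sub>R (f (r\<^sup>2 * ?a) * g (r\<^sup>2 * (sin \<theta>)\<^sup>2)))"
    proof (intro set_lebesgue_integral_cong allI impI)
      fix r :: real assume r: "r \<in> {0<..}"
      have t: "r\<^sup>2 * ?a * ?v = r\<^sup>2 * (sin \<theta>)\<^sup>2"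
        using c by (simp add: tan_def power_divide)
      have "H ?v (r\<^sup>2 * ?a) = (r\<^sup>2 * ?a) *\<^sub>R (f (r\<^sup>2 * ?a) * g (r\<^sup>2 * (sin \<theta>)\<^sup>2))"
        using r c s unfolding H_def F_def G_def t by simp
      moreover have "(2 * tan \<theta> * inverse ?a) * ((2 * r * ?a) * (r\<^sup>2 * ?a))
          = 4 * r ^ 3 * cos \<theta> * sin \<theta>"
        using c by (simp add: tan_def field_simps power2_eq_square power3_eq_cube)
      ultimately show "(2 * tan \<theta> * inverse ?a) *\<^sub>R (2 * r * ?a) *\<^sub>R H ?v (r\<^sup>2 * ?a) =
          (4 * r ^ 3 * cos \<theta> * sin \<theta>) *\<^sub>R (f (r\<^sup>2 * ?a) * g (r\<^sup>2 * (sin \<theta>)\<^sup>2))"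
        by (simp only: scaleR_scaleR)
    qed simp
    finally show "(2 * tan \<theta> * inverse ?a) *\<^sub>R K ?v = (LBINT r:{0<..}.
       (4 * r ^ 3 * cos \<theta> * sin \<theta>) *\<^sub>R (f (r\<^sup>2 * ?a) * g (r\<^sup>2 * (sin \<theta>)\<^sup>2)))" .
  qed simp
  finally show ?thesis .
qed

lemma of_real_powr_eq_exp:
  "t > 0 \<Longrightarrow> of_real t powr z = exp (z * of_real (ln t))" for z :: complex
  by (simp add: powr_def Ln_of_real)

text \<open>
  All bases are positive, so the principal powers are exponentials of multiples of real logarithms
  and multiply without branch corrections. The factor \<open>r\<^sup>3 c s\<close> is the polar Jacobian up to
  the constant 4.
\<close>

lemma polar_powr_collect:
  fixes x y :: complex
  assumes "r > 0" "c > 0" "s > 0"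
  shows "of_real r powr (2 * (x + y) - 1) * of_real c powr (2 * x - 1) * of_real s powr (2 * y - 1)
    = of_real (r ^ 3 * c * s) * (of_real (r\<^sup>2 * c\<^sup>2) powr (x - 1) * of_real (r\<^sup>2 * s\<^sup>2) powr (y - 1))"
proof -
  have "complex_of_real (r ^ 3 * c * s) = of_real (exp (3 * ln r + ln c + ln s))"
    using assms exp_of_nat_mult[of 3 "ln r"] by (simp add: exp_add)
  also have "\<dots> = exp (3 * of_real (ln r) + of_real (ln c) + of_real (ln s))"
    by (simp flip: exp_of_real)
  finally have "complex_of_real (r ^ 3 * c * s) = \<dots>" .
  moreover have "complex_of_real (r\<^sup>2 * u\<^sup>2) powr z = exp (z * (2 * of_real (ln r) + 2 * of_real (ln u)))"
    if "u > 0" for u z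
    using that assms(1)
    by (subst of_real_powr_eq_exp) (simp_all add: ln_mult ln_realpow)
  ultimately show ?thesis
    using assms by (simp only: of_real_powr_eq_exp flip: exp_add) (simp add: algebra_simps)
qed

theorem theorem2p5:
  fixes \<alpha> \<beta> x y p :: complex
  assumes "Re x > 0" and "Re y > 0" and "Re \<alpha> > -1" and "Re p > 0"
    and "Psi_gamma_converges \<alpha> \<beta> p x" and "Psi_gamma_converges \<alpha> \<beta> p y"
  shows "Psi_gamma \<alpha> \<beta> p x * Psi_gamma \<alpha> \<beta> p y =
    4 * (LBINT \<theta>:{0<..<pi/2}. LBINT r:{0<..}.
      of_real r powr (2 * (x + y) - 1)
      * of_real (cos \<theta>) powr (2 * x - 1) * of_real (sin \<theta>) powr (2 * y - 1)
      * wright \<alpha> \<beta> (- of_real (r\<^sup>2 * (cos \<theta>)\<^sup>2) - p / of_real (r\<^sup>2 * (cos \<theta>)\<^sup>2))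
      * wright \<alpha> \<beta> (- of_real (r\<^sup>2 * (sin \<theta>)\<^sup>2) - p / of_real (r\<^sup>2 * (sin \<theta>)\<^sup>2)))"
    (is "_ = 4 * (LBINT \<theta>:_. LBINT r:_. ?I \<theta> r)")
proof -
  let ?f = "Psi_gamma_integrand \<alpha> \<beta> p x" and ?g = "Psi_gamma_integrand \<alpha> \<beta> p y"
  have "Psi_gamma \<alpha> \<beta> p x * Psi_gamma \<alpha> \<beta> p y = (LBINT \<theta>:{0<..<pi/2}. LBINT r:{0<..}.
       (4 * r ^ 3 * cos \<theta> * sin \<theta>) *\<^sub>R (?f (r\<^sup>2 * (cos \<theta>)\<^sup>2) * ?g (r\<^sup>2 * (sin \<theta>)\<^sup>2)))"
    unfolding Psi_gamma_def using assms(5,6) unfolding Psi_gamma_converges_def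
    by (rule product_of_integrals_polar)
  also have "\<dots> = (LBINT \<theta>:{0<..<pi/2}. LBINT r:{0<..}. 4 * ?I \<theta> r)"
  proof (intro set_lebesgue_integral_cong allI impI)
    fix \<theta> r :: real assume \<theta>: "\<theta> \<in> {0<..<pi/2}" and r: "r \<in> {0<..}"
    have "cos \<theta> > 0" "sin \<theta> > 0"
      using \<theta> cos_gt_zero_pi[of \<theta>] sin_gt_zero[of \<theta>] by auto
    with r have "?I \<theta> r = of_real (r ^ 3 * cos \<theta> * sin \<theta>) *
        (?f (r\<^sup>2 * (cos \<theta>)\<^sup>2) * ?g (r\<^sup>2 * (sin \<theta>)\<^sup>2))"
      unfolding Psi_gamma_integrand_def by (subst polar_powr_collect) (simp_all only: greaterThan_iff mult_ac)
    then show "(4 * r ^ 3 * cos \<theta> * sin \<theta>) *\<^sub>R (?f (r\<^sup>2 * (cos \<theta>)\<^sup>2) * ?g (r\<^sup>2 * (sin \<theta>)\<^sup>2))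
        = 4 * ?I \<theta> r"
      by (simp only: scaleR_conv_of_real of_real_mult of_real_numeral mult.assoc)
  qed simp_all
  also have "\<dots> = 4 * (LBINT \<theta>:{0<..<pi/2}. LBINT r:{0<..}. ?I \<theta> r)"
    by simp
  finally show ?thesis .
qed

end
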